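(* The mapping $K\mapsto\varTheta(K)$, assigning to each finite commutative unital ring $K$ its compressed zero-divisor graph $\varTheta(K)$, extends to a functor $\varTheta:\mathbf{FinCRing}\to\mathbf{Graph}$.
   Context: $\mathbf{FinCRing}$ is the category of finite commutative unital rings (the zero ring is included) with ring homomorphisms preserving the identity element. $\mathbf{Graph}$ is the category of undirected graphs (loops allowed, no multiple edges or multiple loops) and graph morphisms, i.e. vertex maps sending adjacent (possibly equal) vertices to adjacent (possibly equal) vertices. On a finite commutative unital ring $K$, elements $a,b$ are associated, $a\sim b$, if $a=bu$ for some invertible $u\in K$; $[a]$ is the class of $a$. The graph $\varTheta(K)$ has as vertices all associatedness classes of elements of $K$ (including $[0]$ and $[1]$), and vertices $[u]$, $[v]$ (not necessarily distinct) are adjacent if and only if $uv=0$. The action on morphisms that is meant is: for a unital ring homomorphism $f:K\to L$, $\varTheta(f):\varTheta(K)\to\varTheta(L)$ is given by $\varTheta(f)([x])=[f(x)]$. *)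

theory Defs
  imports "HOL-Library.FuncSet" "HOL-Algebra.Ring" "Graph_Theory.Pair_Digraph"
begin

section \<open>Categories and functors\<close>

text \<open>
  Arrows carry no source and target of their own; hom-sets are indexed by pairs of objects, and
  so are identities and compositions. \<open>Comp C x y z g f\<close> is the composite of
  \<open>f : x \<rightarrow> y\<close> followed by \<open>g : y \<rightarrow> z\<close>.
\<close>

record ('o, 'm) precategory =
  Obj :: "'o set"
  Hom :: "'o \<Rightarrow> 'o \<Rightarrow> 'm set"
  Ident :: "'o \<Rightarrow> 'm"
  Comp :: "'o \<Rightarrow> 'o \<Rightarrow> 'o \<Rightarrow> 'm \<Rightarrow> 'm \<Rightarrow> 'm"

locale category =
  fixes C :: "('o, 'm) precategory"
  assumes Ident_in_Hom: "x \<in> Obj C \<Longrightarrow> Ident C x \<in> Hom C x x"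
    and Comp_in_Hom:
      "\<lbrakk>x \<in> Obj C; y \<in> Obj C; z \<in> Obj C; f \<in> Hom C x y; g \<in> Hom C y z\<rbrakk>
        \<Longrightarrow> Comp C x y z g f \<in> Hom C x z"
    and Comp_Ident_right:
      "\<lbrakk>x \<in> Obj C; y \<in> Obj C; f \<in> Hom C x y\<rbrakk> \<Longrightarrow> Comp C x x y f (Ident C x) = f"
    and Comp_Ident_left:
      "\<lbrakk>x \<in> Obj C; y \<in> Obj C; f \<in> Hom C x y\<rbrakk> \<Longrightarrow> Comp C x y y (Ident C y) f = f"
    and Comp_assoc:
      "\<lbrakk>w \<in> Obj C; x \<in> Obj C; y \<in> Obj C; z \<in> Obj C;
        f \<in> Hom C w x; g \<in> Hom C x y; h \<in> Hom C y z\<rbrakk>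
        \<Longrightarrow> Comp C w y z h (Comp C w x y g f) = Comp C w x z (Comp C x y z h g) f"

locale cat_functor = source: category C + target: category D
  for C :: "('o, 'm) precategory" and D :: "('p, 'n) precategory" +
  fixes F :: "'o \<Rightarrow> 'p" and F\<^sub>m :: "'o \<Rightarrow> 'o \<Rightarrow> 'm \<Rightarrow> 'n"
  assumes F_Obj: "x \<in> Obj C \<Longrightarrow> F x \<in> Obj D"
    and F_Hom:
      "\<lbrakk>x \<in> Obj C; y \<in> Obj C; f \<in> Hom C x y\<rbrakk> \<Longrightarrow> F\<^sub>m x y f \<in> Hom D (F x) (F y)"
    and F_Ident: "x \<in> Obj C \<Longrightarrow> F\<^sub>m x x (Ident C x) = Ident D (F x)"
    and F_Comp:
      "\<lbrakk>x \<in> Obj C; y \<in> Obj C; z \<in> Obj C; f \<in> Hom C x y; g \<in> Hom C y z\<rbrakk>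
        \<Longrightarrow> F\<^sub>m x z (Comp C x y z g f) = Comp D (F x) (F y) (F z) (F\<^sub>m y z g) (F\<^sub>m x y f)"

section \<open>Finite commutative rings and undirected graphs\<close>

text \<open>
  The type parameter serves as an arbitrary universe for ring carriers and graph vertices.
  Finitely many rings on different types can be transported to one type, e.g. their sum.
  Arrows are functions that are undefined outside their domain, so that two arrows are equal
  if and only if they agree on the domain. Note that \<^const>\<open>cring\<close> does not exclude the zero
  ring, and that \<^const>\<open>ring_hom\<close> requires preservation of the identity element.
\<close>

definition FinCRing :: "('a ring, 'a \<Rightarrow> 'a) precategory" where
  "FinCRing = \<lparr>
     Obj = {K. cring K \<and> finite (carrier K)},
     Hom = (\<lambda>K L. ring_hom K L \<inter> extensional (carrier K)),
     Ident = (\<lambda>K. \<lambda>x\<in>carrier K. x),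
     Comp = (\<lambda>K L M g f. compose (carrier K) g f)\<rparr>"

text \<open>
  An undirected graph with loops allowed and without multiple edges is a vertex set together
  with a symmetric, not necessarily irreflexive, relation on it.
\<close>

definition Graph :: "('v pair_pre_digraph, 'v \<Rightarrow> 'v) precategory" where
  "Graph = \<lparr>
     Obj = {G. pair_sym_digraph G},
     Hom = (\<lambda>G H. {\<phi> \<in> pverts G \<rightarrow>\<^sub>E pverts H.
              \<forall>u v. (u, v) \<in> parcs G \<longrightarrow> (\<phi> u, \<phi> v) \<in> parcs H}),
     Ident = (\<lambda>G. \<lambda>v\<in>pverts G. v),
     Comp = (\<lambda>G H I \<psi> \<phi>. compose (pverts G) \<psi> \<phi>)\<rparr>"

section \<open>The compressed zero-divisor graph\<close>

text \<open>
  Elements are associated if they differ by a unit factor; \<open>associated\<close> in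
  \<open>HOL-Algebra.Divisibility\<close> means mutual divisibility instead.
\<close>

definition assoc_rel :: "('a, 'b) ring_scheme \<Rightarrow> 'a rel" where
  "assoc_rel K = {(a, b) \<in> carrier K \<times> carrier K. \<exists>u\<in>Units K. a = b \<otimes>\<^bsub>K\<^esub> u}"

definition assoc_class :: "('a, 'b) ring_scheme \<Rightarrow> 'a \<Rightarrow> 'a set" where
  "assoc_class K a = assoc_rel K `` {a}"

definition Theta :: "('a, 'b) ring_scheme \<Rightarrow> 'a set pair_pre_digraph" where
  "Theta K = \<lparr>
     pverts = carrier K // assoc_rel K,
     parcs = {(assoc_class K u, assoc_class K v) |u v.
                u \<in> carrier K \<and> v \<in> carrier K \<and> u \<otimes>\<^bsub>K\<^esub> v = \<zero>\<^bsub>K\<^esub>}\<rparr>"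

text \<open>
  The image of a class \<open>X\<close> is the common value of \<open>[f x]\<close> for all \<open>x \<in> X\<close>
  (\<^const>\<open>the_elem\<close> is unspecified if there is no such common value).
\<close>

definition Theta_map ::
    "('a, 'c) ring_scheme \<Rightarrow> ('b, 'd) ring_scheme \<Rightarrow> ('a \<Rightarrow> 'b) \<Rightarrow> 'a set \<Rightarrow> 'b set" where
  "Theta_map K L f = (\<lambda>X\<in>pverts (Theta K). the_elem ((\<lambda>x. assoc_class L (f x)) ` X))"

text \<open>
  Associatedness is an equivalence relation, and adjacency does not depend on the choice of
  representatives.
\<close>

lemma equiv_assoc_rel:
  assumes "cring K"
  shows "equiv (carrier K) (assoc_rel K)"
proof -
  interpret cring K by fact
  show ?thesis
  proof (rule equivI)
    show "assoc_rel K \<subseteq> carrier K \<times> carrier K"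
      by (auto simp: assoc_rel_def)
    show "refl_on (carrier K) (assoc_rel K)"
      by (auto simp: assoc_rel_def refl_on_def intro!: bexI[of _ "\<one>\<^bsub>K\<^esub>"])
    show "sym (assoc_rel K)"
    proof (rule symI)
      fix a b assume "(a, b) \<in> assoc_rel K"
      then obtain u where ab: "a \<in> carrier K" "b \<in> carrier K" and u: "u \<in> Units K"
        and "a = b \<otimes>\<^bsub>K\<^esub> u" by (auto simp: assoc_rel_def)
      then have "b = a \<otimes>\<^bsub>K\<^esub> inv\<^bsub>K\<^esub> u"
        by (simp add: m_assoc Units_closed Units_inv_closed Units_r_inv)
      with ab Units_inv_Units[OF u] show "(b, a) \<in> assoc_rel K"
        by (auto simp: assoc_rel_def)
    qed
    show "trans (assoc_rel K)"
    proof (rule transI)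
      fix a b c assume "(a, b) \<in> assoc_rel K" "(b, c) \<in> assoc_rel K"
      then obtain u v where "a \<in> carrier K" "c \<in> carrier K" "u \<in> Units K" "v \<in> Units K"
        and "a = c \<otimes>\<^bsub>K\<^esub> v \<otimes>\<^bsub>K\<^esub> u"
        by (auto simp: assoc_rel_def)
      then show "(a, c) \<in> assoc_rel K"
        by (auto simp: assoc_rel_def m_assoc Units_closed intro!: bexI[of _ "v \<otimes>\<^bsub>K\<^esub> u"])
    qed
  qed
qed

lemma Theta_adj_iff:
  assumes "cring K" "u \<in> carrier K" "v \<in> carrier K"
  shows "(assoc_class K u, assoc_class K v) \<in> parcs (Theta K)
          \<longleftrightarrow> u \<otimes>\<^bsub>K\<^esub> v = \<zero>\<^bsub>K\<^esub>"
proof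
  interpret cring K by fact
  assume "(assoc_class K u, assoc_class K v) \<in> parcs (Theta K)"
  then obtain a b where ab: "a \<in> carrier K" "b \<in> carrier K" "a \<otimes>\<^bsub>K\<^esub> b = \<zero>\<^bsub>K\<^esub>"
    and eq: "assoc_class K u = assoc_class K a" "assoc_class K v = assoc_class K b"
    by (auto simp: Theta_def)
  have "(u, a) \<in> assoc_rel K" "(v, b) \<in> assoc_rel K"
    using eq eq_equiv_class[OF _ equiv_assoc_rel[OF assms(1)]] ab
    unfolding assoc_class_def by blast+
  then obtain p q where pq: "p \<in> Units K" "q \<in> Units K"
    and "u = a \<otimes>\<^bsub>K\<^esub> p" "v = b \<otimes>\<^bsub>K\<^esub> q"
    by (auto simp: assoc_rel_def)
  then have "u \<otimes>\<^bsub>K\<^esub> v = (a \<otimes>\<^bsub>K\<^esub> b) \<otimes>\<^bsub>K\<^esub> (p \<otimes>\<^bsub>K\<^esub> q)"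
    using ab(1,2) by (simp add: Units_closed m_ac)
  then show "u \<otimes>\<^bsub>K\<^esub> v = \<zero>\<^bsub>K\<^esub>"
    using ab(3) pq by (simp add: Units_closed)
qed (use assms in \<open>auto simp: Theta_def\<close>)

end

theory Submission
  imports Defs
begin

text \<open>
  A ring homomorphism preserves units and products, hence it maps associated elements to associated
  elements and zero products to zero products. So \<open>[x] \<mapsto> [f x]\<close> is well defined and preserves
  adjacency; functoriality is then read off on representatives.
\<close>

text \<open>The image of the inverse inverts the image, because \<open>f\<close> preserves products
  and the identity.\<close>

lemma ring_hom_Units:
  assumes "cring K" "f \<in> ring_hom K L" "u \<in> Units K"
  shows "f u \<in> Units L"
proof -
  interpret K: cring K by fact
  have u: "u \<in> carrier K" "inv\<^bsub>K\<^esub> u \<in> carrier K"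
    using assms(3) by auto
  have "f (inv\<^bsub>K\<^esub> u) \<otimes>\<^bsub>L\<^esub> f u = \<one>\<^bsub>L\<^esub>" "f u \<otimes>\<^bsub>L\<^esub> f (inv\<^bsub>K\<^esub> u) = \<one>\<^bsub>L\<^esub>"
    using assms(2,3) u ring_hom_one[OF assms(2)]
    by (simp_all flip: ring_hom_mult[OF assms(2)] add: K.Units_l_inv K.Units_r_inv)
  with u show ?thesis
    using ring_hom_closed[OF assms(2)] by (auto simp: Units_def)
qed

text \<open>Makes the class of \<open>f x\<close> independent of the representative
  \<open>x\<close>: a unit factor \<open>u\<close> becomes the unit factor
  \<open>f u\<close>.\<close>

lemma ring_hom_assoc_rel:
  assumes "cring K" "f \<in> ring_hom K L" "(a, b) \<in> assoc_rel K"
  shows "(f a, f b) \<in> assoc_rel L"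
proof -
  interpret K: cring K by fact
  obtain u where ab: "a \<in> carrier K" "b \<in> carrier K" and u: "u \<in> Units K"
    and "a = b \<otimes>\<^bsub>K\<^esub> u"
    using assms(3) by (auto simp: assoc_rel_def)
  then have "f a = f b \<otimes>\<^bsub>L\<^esub> f u"
    by (simp add: ring_hom_mult[OF assms(2)] K.Units_closed)
  moreover have "f a \<in> carrier L" "f b \<in> carrier L"
    using ab by (auto intro: ring_hom_closed[OF assms(2)])
  ultimately show ?thesis
    using ring_hom_Units[OF assms(1,2) u] by (auto simp: assoc_rel_def)
qed

lemma assoc_class_in_pverts: "x \<in> carrier K \<Longrightarrow> assoc_class K x \<in> pverts (Theta K)"
  by (auto simp: Theta_def assoc_class_def quotientI)

lemma pverts_ThetaE:
  assumes "X \<in> pverts (Theta K)"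
  obtains x where "x \<in> carrier K" "X = assoc_class K x"
  using assms by (auto simp: Theta_def assoc_class_def elim: quotientE)

text \<open>The representatives of one class all yield the same class in \<open>L\<close>, so
  \<open>the_elem\<close> is applied to a singleton. Every later computation with
  \<open>Theta_map\<close> goes through this equation.\<close>

lemma Theta_map_assoc_class:
  assumes "cring K" "cring L" "f \<in> ring_hom K L" "x \<in> carrier K"
  shows "Theta_map K L f (assoc_class K x) = assoc_class L (f x)"
proof -
  have eq: "assoc_class L (f y) = assoc_class L (f x)" if "y \<in> assoc_class K x" for y
    using that equiv_class_eq[OF equiv_assoc_rel[OF assms(2)] ring_hom_assoc_rel[OF assms(1,3)]]
    by (auto simp: assoc_class_def)
  \<comment> \<open>Rules out an empty image, on which \<open>the_elem\<close> would be
    unspecified.\<close>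
  have "x \<in> assoc_class K x"
    using equiv_class_self[OF equiv_assoc_rel[OF assms(1)] assms(4)] by (simp add: assoc_class_def)
  with eq have "(\<lambda>y. assoc_class L (f y)) ` assoc_class K x = {assoc_class L (f x)}"
    by blast
  then show ?thesis
    using assms(4) by (simp add: Theta_map_def assoc_class_in_pverts)
qed

lemma pair_sym_digraph_Theta:
  assumes "cring K"
  shows "pair_sym_digraph (Theta K)"
proof -
  interpret cring K by fact
  have "sym (parcs (Theta K))"
    \<comment> \<open>Commutativity turns a vanishing product \<open>u \<otimes> v\<close> into a
      vanishing \<open>v \<otimes> u\<close>.\<close>
    by (rule symI) (auto simp: Theta_def intro: m_comm[THEN trans])
  then show ?thesis
    by unfold_locales
      (auto simp: symmetric_def Theta_def assoc_class_def quotientI)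
qed

lemma Theta_map_in_Hom:
  assumes "cring K" "cring L" "f \<in> ring_hom K L"
  shows "Theta_map K L f \<in> Hom Graph (Theta K) (Theta L)"
proof -
  interpret K: cring K by fact
  interpret L: cring L by fact
  have "Theta_map K L f \<in> pverts (Theta K) \<rightarrow>\<^sub>E pverts (Theta L)"
  proof (rule PiE_I)
    fix X assume "X \<in> pverts (Theta K)"
    then show "Theta_map K L f X \<in> pverts (Theta L)"
      by (elim pverts_ThetaE)
        (simp add: Theta_map_assoc_class[OF assms] assoc_class_in_pverts ring_hom_closed[OF assms(3)])
  qed (simp add: Theta_map_def)
  moreover have "(Theta_map K L f X, Theta_map K L f Y) \<in> parcs (Theta L)"
    if adj: "(X, Y) \<in> parcs (Theta K)" for X Y
  proof -
    \<comment> \<open>An arc comes with representatives whose product is zero; \<open>f\<close>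
      carries this equation to \<open>L\<close>.\<close>
    obtain u v where uv: "u \<in> carrier K" "v \<in> carrier K" "u \<otimes>\<^bsub>K\<^esub> v = \<zero>\<^bsub>K\<^esub>"
      and XY: "X = assoc_class K u" "Y = assoc_class K v"
      using adj by (auto simp: Theta_def)
    have "f u \<otimes>\<^bsub>L\<^esub> f v = \<zero>\<^bsub>L\<^esub>"
      using uv ring_hom_zero[OF assms(3) K.ring_axioms L.ring_axioms]
      by (simp flip: ring_hom_mult[OF assms(3)])
    then show ?thesis
      using uv(1,2) XY ring_hom_closed[OF assms(3)] assms
      by (simp add: Theta_map_assoc_class Theta_adj_iff)
  qed
  ultimately show ?thesis
    by (auto simp: Graph_def)
qed

lemma category_FinCRing: "category FinCRing"
proof
  fix K L M :: "'a ring" and f g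
  assume "f \<in> Hom FinCRing K L" "g \<in> Hom FinCRing L M" "K \<in> Obj FinCRing"
  \<comment> \<open>The restricted composite has the value \<open>g (f x)\<close> only on
    \<open>carrier K\<close>; closure of \<open>K\<close> under its operations keeps sums, products
    and the identity there.\<close>
  then show "Comp FinCRing K L M g f \<in> Hom FinCRing K M"
    by (auto simp: FinCRing_def ring_hom_def compose_def Pi_iff cring_def
        ring.ring_simprules)
next
  fix J K L M :: "'a ring" and f g h
  assume "f \<in> Hom FinCRing J K"
  \<comment> \<open>On the right the inner composite is restricted to \<open>carrier K\<close>,
    which contains the values of \<open>f\<close> on \<open>carrier J\<close>.\<close>
  then show "Comp FinCRing J L M h (Comp FinCRing J K L g f)
      = Comp FinCRing J K M (Comp FinCRing K L M h g) f"
    by (auto simp: FinCRing_def ring_hom_def intro: compose_assoc)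
qed (auto simp: FinCRing_def ring_hom_def cring_def ring.ring_simprules
      intro: compose_Id Id_compose)

lemma category_Graph: "category Graph"
proof
  fix G H I :: "'a pair_pre_digraph" and f g
  assume "f \<in> Hom Graph G H" "g \<in> Hom Graph H I" "G \<in> Obj Graph"
  \<comment> \<open>Well-formedness of \<open>G\<close> puts the ends of each arc among the
    vertices, where the restricted composite is not undefined.\<close>
  then show "Comp Graph G H I g f \<in> Hom Graph G I"
    by (auto simp: Graph_def compose_def pair_sym_digraph_def
        pair_wf_digraph.in_arcsD1 pair_wf_digraph.in_arcsD2)
next
  fix G H I J :: "'a pair_pre_digraph" and f g h
  assume "f \<in> Hom Graph G H"
  then show "Comp Graph G I J h (Comp Graph G H I g f)
      = Comp Graph G H J (Comp Graph H I J h g) f"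
    by (auto simp: Graph_def PiE_def intro: compose_assoc)
qed (auto simp: Graph_def PiE_def pair_sym_digraph_def
      pair_wf_digraph.in_arcsD1 pair_wf_digraph.in_arcsD2 intro: compose_Id Id_compose)

theorem proposition3p3:
  shows "cat_functor (FinCRing :: ('a ring, 'a \<Rightarrow> 'a) precategory)
           (Graph :: ('a set pair_pre_digraph, 'a set \<Rightarrow> 'a set) precategory)
           Theta Theta_map
         \<and> (\<forall>K \<in> Obj (FinCRing :: ('a ring, 'a \<Rightarrow> 'a) precategory).
             \<forall>L \<in> Obj FinCRing. \<forall>f \<in> Hom FinCRing K L. \<forall>x \<in> carrier K.
               Theta_map K L f (assoc_class K x) = assoc_class L (f x))"
proof
  have FinCRing_simps [simp]:
    "Obj FinCRing = {K :: 'a ring. cring K \<and> finite (carrier K)}"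
    "Hom FinCRing = (\<lambda>K L :: 'a ring. ring_hom K L \<inter> extensional (carrier K))"
    "Ident FinCRing = (\<lambda>K :: 'a ring. \<lambda>x\<in>carrier K. x)"
    "Comp FinCRing = (\<lambda>K L M :: 'a ring. compose (carrier K))"
    by (auto simp: FinCRing_def)
  show "\<forall>K \<in> Obj (FinCRing :: ('a ring, 'a \<Rightarrow> 'a) precategory).
      \<forall>L \<in> Obj FinCRing. \<forall>f \<in> Hom FinCRing K L. \<forall>x \<in> carrier K.
        Theta_map K L f (assoc_class K x) = assoc_class L (f x)"
    by (simp add: Theta_map_assoc_class)
  interpret FinCRing: category "FinCRing :: ('a ring, 'a \<Rightarrow> 'a) precategory"
    by (rule category_FinCRing)
  interpret Graph: category "Graph :: ('a set pair_pre_digraph, 'a set \<Rightarrow> 'a set) precategory"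
    by (rule category_Graph)
  show "cat_functor (FinCRing :: ('a ring, 'a \<Rightarrow> 'a) precategory)
      (Graph :: ('a set pair_pre_digraph, 'a set \<Rightarrow> 'a set) precategory) Theta Theta_map"
  proof
    fix K :: "'a ring"
    assume K: "K \<in> Obj FinCRing"
    then show "Theta K \<in> Obj Graph"
      by (simp add: Graph_def pair_sym_digraph_Theta)
    show "Theta_map K K (Ident FinCRing K) = Ident Graph (Theta K)"
    \<comment> \<open>Both sides are undefined off the vertices, so it suffices to compare them on
      classes \<open>[x]\<close>, and both fix these.\<close>
    proof (rule extensionalityI[where A = "pverts (Theta K)"])
      fix X assume "X \<in> pverts (Theta K)"
      then show "Theta_map K K (Ident FinCRing K) X = Ident Graph (Theta K) X"
        using FinCRing.Ident_in_Hom[OF K] K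
        by (elim pverts_ThetaE)
          (simp add: Theta_map_assoc_class Graph_def assoc_class_in_pverts)
    qed (simp_all add: Theta_map_def Graph_def)
  next
    fix K L :: "'a ring" and f
    assume "K \<in> Obj FinCRing" "L \<in> Obj FinCRing" "f \<in> Hom FinCRing K L"
    then show "Theta_map K L f \<in> Hom Graph (Theta K) (Theta L)"
      by (simp add: Theta_map_in_Hom)
  next
    fix K L M :: "'a ring" and f g
    assume K: "K \<in> Obj FinCRing" and L: "L \<in> Obj FinCRing" and M: "M \<in> Obj FinCRing"
      and f: "f \<in> Hom FinCRing K L" and g: "g \<in> Hom FinCRing L M"
    show "Theta_map K M (Comp FinCRing K L M g f)
        = Comp Graph (Theta K) (Theta L) (Theta M) (Theta_map L M g) (Theta_map K L f)"
    proof (rule extensionalityI[where A = "pverts (Theta K)"])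
      fix X assume "X \<in> pverts (Theta K)"
      then obtain x where x: "x \<in> carrier K" "X = assoc_class K x"
        by (rule pverts_ThetaE)
      \<comment> \<open>Lets the formula on representatives be applied a second time, to
        \<open>g\<close> at \<open>[f x]\<close>; both sides then equal
        \<open>[g (f x)]\<close>.\<close>
      moreover have "f x \<in> carrier L"
        using f x(1) by (auto intro: ring_hom_closed)
      ultimately show "Theta_map K M (Comp FinCRing K L M g f) X
          = Comp Graph (Theta K) (Theta L) (Theta M) (Theta_map L M g) (Theta_map K L f) X"
        using FinCRing.Comp_in_Hom[OF K L M f g] K L M f g
        by (simp add: Theta_map_assoc_class Graph_def assoc_class_in_pverts compose_eq)
    qed (simp_all add: Theta_map_def Graph_def)
  qed
qed

end
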